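(* Let $l$, $s$ and $n$ be positive integers. (a) If $l\ge n$, then $\varepsilon_{n,l}=1$. (b) Suppose $l<n$, let $d$ and $r\le n$ be positive integers and put $\delta=r^2-nld^2$. (i) If $nl$ is a perfect square, then $\varepsilon_{n,l}=\sqrt{l/n}$. (ii) We have $$\varepsilon_{n,l}\ge\sqrt{\tfrac ln}\sqrt{1-\tfrac{\delta}{r^2}}\ \text{ if }\delta\ge 0,\qquad \varepsilon_{n,l}\ge\sqrt{\tfrac ln}\sqrt{1+\tfrac{\delta}{nld^2}}\ \text{ if }\delta\le 0,$$ with equality (in the respective case) if $\delta=\pm1$. (iii) If $n>2$, then $$\varepsilon_{n,l}>\sqrt{\tfrac ln}\sqrt{1-\tfrac1n}$$ holds for at least half of the integers $l$ with $(n-1)/2\le l\le n-1$. Alternatively, given a positive integer $l$, any positive integer $a$ and any integer $s>2$, the fraction of the integers $n$ in the range $s^2l\le n<(s+1)^2l$ for which $$\varepsilon_{n,l}>\sqrt{\tfrac ln}\sqrt{1-\tfrac1{an}}$$ fails to hold is at most $\frac{(2a^2-a+8)l+3}{l(2s+1)}$ if $a>2$, at most $\frac{14l+3}{l(2s+1)}$ if $a=2$, and at most $\frac{4l+2}{l(2s+1)}$ if $a=1$, and thus goes to $0$ as $s$ increases. (c) If neither $n+1$ nor $n-1$ is a perfect square, then $$\varepsilon_n>\frac1{\sqrt{n+1}}>\sqrt{\tfrac1n}\sqrt{1-\tfrac1n}.$$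
   Context: For positive integers $n,l$ define sets (with $r,d$ ranging over integers) $$S_1(n,l)=\Bigl\{\tfrac{r}{nd}\;\Big|\;1\le r\le n,\ 1\le d,\ \tfrac rd\le\sqrt{nl}\Bigr\},\qquad S_2(n,l)=\Bigl\{\tfrac{dl}{r}\;\Big|\;1\le r\le n,\ 1\le d,\ \tfrac rd\ge\sqrt{nl}\Bigr\},$$ $S(n,l)=S_1(n,l)\cup S_2(n,l)$, and $\varepsilon_{n,l}=\max S(n,l)$. Write $\varepsilon_n$ for $\varepsilon_{n,1}$. *)

theory Defs
  imports "HOL-Analysis.Analysis" "HOL-Computational_Algebra.Nth_Powers"
begin

definition S1 :: "nat \<Rightarrow> nat \<Rightarrow> real set" where
  "S1 n l = {real r / (real n * real d) | r d :: nat.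
     1 \<le> r \<and> r \<le> n \<and> 1 \<le> d \<and> real r / real d \<le> sqrt (real n * real l)}"

definition S2 :: "nat \<Rightarrow> nat \<Rightarrow> real set" where
  "S2 n l = {real d * real l / real r | r d :: nat.
     1 \<le> r \<and> r \<le> n \<and> 1 \<le> d \<and> real r / real d \<ge> sqrt (real n * real l)}"

definition S :: "nat \<Rightarrow> nat \<Rightarrow> real set" where
  "S n l = S1 n l \<union> S2 n l"

text \<open>The set \<open>S1 n l\<close> is infinite, since \<open>d\<close> is unbounded in it, so the library's \<open>Max\<close>
  (meaningful for finite sets only) is not applicable. That the maximum exists is
  \<open>eps_is_max\<close> below.\<close>

definition eps :: "nat \<Rightarrow> nat \<Rightarrow> real" where
  "eps n l = (GREATEST x. x \<in> S n l)"

definition failure_fraction :: "nat \<Rightarrow> nat \<Rightarrow> nat \<Rightarrow> real" where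
  "failure_fraction l a s =
     real (card {n. s\<^sup>2 * l \<le> n \<and> n < (s + 1)\<^sup>2 * l \<and>
       \<not> eps n l > sqrt (real l / real n) * sqrt (1 - 1 / (real a * real n))})
     / real (card {n. s\<^sup>2 * l \<le> n \<and> n < (s + 1)\<^sup>2 * l})"

lemma eps_is_max:
  assumes "0 < n" "0 < l"
  shows "eps n l \<in> S n l \<and> (\<forall>x\<in>S n l. x \<le> eps n l)"
proof -
  define q where "q = sqrt (real n * real l)"
  have q: "q \<ge> 1"
    using assms unfolding q_def by (metis One_nat_def Suc_leI nat_0_less_mult_iff of_nat_1
        of_nat_le_iff of_nat_mult real_sqrt_ge_1_iff)
  define c where "c = 1 / real n"
  have "c > 0" using assms by (simp add: c_def)
  have c: "c \<in> S n l"
    unfolding S_def S1_def c_def using assms q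
    by (intro UnI1 CollectI exI[of _ 1]) (auto simp: q_def)
  define T where "T = {x \<in> S n l. c \<le> x}"
  have "T \<subseteq> (\<lambda>(r, d). real r / (real n * real d)) ` ({..n} \<times> {..n})
          \<union> (\<lambda>(r, d). real d * real l / real r) ` ({..n} \<times> {..n})"
  proof
    fix x assume "x \<in> T"
    then have x: "x \<in> S n l" "c \<le> x" by (auto simp: T_def)
    from x(1) consider "x \<in> S1 n l" | "x \<in> S2 n l" by (auto simp: S_def)
    then show "x \<in> (\<lambda>(r, d). real r / (real n * real d)) ` ({..n} \<times> {..n})
          \<union> (\<lambda>(r, d). real d * real l / real r) ` ({..n} \<times> {..n})"
    proof cases
      case 1
      then obtain r d where rd: "x = real r / (real n * real d)" "r \<le> n" "1 \<le> d"
        by (auto simp: S1_def)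
      have "real d \<le> real r"
        using x(2) rd assms by (simp add: c_def field_simps)
      then show ?thesis using rd by (intro UnI1 image_eqI[of _ _ "(r, d)"]) auto
    next
      case 2
      then obtain r d where rd: "x = real d * real l / real r" "r \<le> n" "1 \<le> d"
        "real r / real d \<ge> q"
        by (auto simp: S2_def q_def)
      have "1 \<le> real r / real d" using q rd(4) by linarith
      then have "real d \<le> real r" using rd(3) by (simp add: field_simps)
      then show ?thesis using rd by (intro UnI2 image_eqI[of _ _ "(r, d)"]) auto
    qed
  qed
  then have fin: "finite T" by (rule finite_subset) auto
  have "c \<in> T" using c by (simp add: T_def)
  then have M: "Max T \<in> T" "\<And>x. x \<in> T \<Longrightarrow> x \<le> Max T" "c \<le> Max T"
    using fin by (auto intro: Max_in)
  have ub: "x \<le> Max T" if "x \<in> S n l" for x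
    using that M(2)[of x] M(3) by (cases "c \<le> x") (auto simp: T_def)
  have "Max T \<in> S n l" using M(1) by (simp add: T_def)
  moreover have "eps n l = Max T"
    unfolding eps_def by (rule Greatest_equality) (use calculation ub in auto)
  ultimately show ?thesis using ub by simp
qed

end

(*
  Writing N = n l, every element of S(n,l) is sqrt(l/n) times the smaller of rho/sqrt N and
  sqrt N/rho, with rho = r/d and r <= n, so eps measures how well sqrt N is approximated by
  fractions r/d with r <= n.

  If r^2 - N d^2 is 1 or -1, a strictly better fraction r'/d' would satisfy
  r' = r A + N d B with integers A, B >= 1, hence r' > n.

  For s^2 l <= n < (s+1)^2 l, Dirichlet's theorem in its sharp form (error at most 1/(s+1) with
  d <= s) yields r <= n with |r^2 - N d^2| < 2 d l. This is good enough when d >= 2a; otherwise n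
  lies within 2/d of r^2/(l d^2), and one counts the n near these few points. The case
  l = a = 1, s = floor (sqrt n) gives part (c): there d = 1 would force r^2 to be n or n +- 1.

  For the first claim in (iii), each r with 5n/7 <= r < n makes l = round(r^2/n) good (with d = 1),
  and distinct r give distinct l.
*)

theory Submission
  imports Defs
begin

section \<open>Bounds from admissible pairs\<close>

text \<open>Together with its mirror image \<open>sqrt_le_ratio_iff\<close>, this replaces the
  irrational side condition of \<open>S1\<close> and \<open>S2\<close> by a comparison of naturals,
  so that later arguments can speak of pairs (r, d) only.\<close>

lemma ratio_le_sqrt_iff:
  assumes "0 < d"
  shows "real r / real d \<le> sqrt (real n * real l) \<longleftrightarrow> r\<^sup>2 \<le> n * l * d\<^sup>2"
proof -
  have "real r / real d \<le> sqrt (real n * real l) \<longleftrightarrow> real r \<le> sqrt (real n * real l) * real d"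
    using assms by (simp add: divide_le_eq)
  also have "\<dots> \<longleftrightarrow> real r \<le> sqrt (real (n * l * d\<^sup>2))"
    by (simp add: real_sqrt_mult)
  also have "\<dots> \<longleftrightarrow> (real r)\<^sup>2 \<le> real (n * l * d\<^sup>2)"
    using real_sqrt_le_iff[of "(real r)\<^sup>2" "real (n * l * d\<^sup>2)"] by simp
  also have "\<dots> \<longleftrightarrow> r\<^sup>2 \<le> n * l * d\<^sup>2"
    by (metis of_nat_le_iff of_nat_power)
  finally show ?thesis .
qed

lemma sqrt_le_ratio_iff:
  assumes "0 < d"
  shows "sqrt (real n * real l) \<le> real r / real d \<longleftrightarrow> n * l * d\<^sup>2 \<le> r\<^sup>2"
proof -
  have "sqrt (real n * real l) \<le> real r / real d \<longleftrightarrow> sqrt (real n * real l) * real d \<le> real r"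
    using assms by (simp add: le_divide_eq)
  also have "\<dots> \<longleftrightarrow> sqrt (real (n * l * d\<^sup>2)) \<le> real r"
    by (simp add: real_sqrt_mult)
  also have "\<dots> \<longleftrightarrow> real (n * l * d\<^sup>2) \<le> (real r)\<^sup>2"
    using real_sqrt_le_iff[of "real (n * l * d\<^sup>2)" "(real r)\<^sup>2"] by simp
  also have "\<dots> \<longleftrightarrow> n * l * d\<^sup>2 \<le> r\<^sup>2"
    by (metis of_nat_le_iff of_nat_power)
  finally show ?thesis .
qed

lemma eps_ge_below:
  assumes "0 < n" "0 < l" "0 < r" "r \<le> n" "0 < d" "r\<^sup>2 \<le> n * l * d\<^sup>2"
  shows "real r / (real n * real d) \<le> eps n l"
proof -
  have "real r / (real n * real d) \<in> S n l"
    using assms ratio_le_sqrt_iff[of d r n l]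
    unfolding S_def S1_def by (intro UnI1 CollectI exI[of _ r] exI[of _ d]) auto
  then show ?thesis using eps_is_max assms(1,2) by blast
qed

lemma eps_ge_above:
  assumes "0 < n" "0 < l" "0 < r" "r \<le> n" "0 < d" "n * l * d\<^sup>2 \<le> r\<^sup>2"
  shows "real d * real l / real r \<le> eps n l"
proof -
  have "real d * real l / real r \<in> S n l"
    using assms sqrt_le_ratio_iff[of d n l r]
    unfolding S_def S2_def by (intro UnI2 CollectI exI[of _ r] exI[of _ d]) auto
  then show ?thesis using eps_is_max assms(1,2) by blast
qed

lemma eps_leI:
  assumes "0 < n" "0 < l"
    and "\<And>r d. \<lbrakk>0 < r; r \<le> n; 0 < d; r\<^sup>2 \<le> n * l * d\<^sup>2\<rbrakk> \<Longrightarrow> real r / (real n * real d) \<le> b"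
    and "\<And>r d. \<lbrakk>0 < r; r \<le> n; 0 < d; n * l * d\<^sup>2 \<le> r\<^sup>2\<rbrakk> \<Longrightarrow> real d * real l / real r \<le> b"
  shows "eps n l \<le> b"
proof -
  from eps_is_max[OF assms(1,2)] consider "eps n l \<in> S1 n l" | "eps n l \<in> S2 n l"
    by (auto simp: S_def)
  then show ?thesis
  proof cases
    case 1
    then show ?thesis
      using assms(3) ratio_le_sqrt_iff unfolding S1_def by fastforce
  next
    case 2
    then show ?thesis
      using assms(4) sqrt_le_ratio_iff unfolding S2_def by fastforce
  qed
qed

text \<open>The radicand 1 - \<open>\<delta>\<close>/r^2 equals n l d^2/r^2, so the bound of (b)(ii)
  is nothing but the number that the pair (r, d) contributes to \<open>S2\<close>. The next lemma
  does the same for \<open>S1\<close>.\<close>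

lemma scaled_ratio_above:
  fixes \<delta> :: int
  assumes "0 < n" "0 < r" "\<delta> = (int r)\<^sup>2 - int n * int l * (int d)\<^sup>2"
  shows "sqrt (real l / real n) * sqrt (1 - real_of_int \<delta> / (real r)\<^sup>2) = real d * real l / real r"
proof -
  have "1 - real_of_int \<delta> / (real r)\<^sup>2 = real n * real l * (real d)\<^sup>2 / (real r)\<^sup>2"
    using assms(1,2) by (simp add: assms(3) field_simps)
  then have "sqrt (real l / real n) * sqrt (1 - real_of_int \<delta> / (real r)\<^sup>2)
      = sqrt (real l / real n * (real n * real l * (real d)\<^sup>2 / (real r)\<^sup>2))"
    by (simp only: real_sqrt_mult)
  also have "real l / real n * (real n * real l * (real d)\<^sup>2 / (real r)\<^sup>2) = (real d * real l / real r)\<^sup>2"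
    using assms by (simp add: field_simps power2_eq_square)
  finally show ?thesis by simp
qed

lemma scaled_ratio_below:
  fixes \<delta> :: int
  assumes "0 < n" "0 < l" "0 < d" "\<delta> = (int r)\<^sup>2 - int n * int l * (int d)\<^sup>2"
  shows "sqrt (real l / real n) * sqrt (1 + real_of_int \<delta> / (real n * real l * (real d)\<^sup>2))
    = real r / (real n * real d)"
proof -
  have "1 + real_of_int \<delta> / (real n * real l * (real d)\<^sup>2) = (real r)\<^sup>2 / (real n * real l * (real d)\<^sup>2)"
    using assms(1-3) by (simp add: assms(4) field_simps)
  then have "sqrt (real l / real n) * sqrt (1 + real_of_int \<delta> / (real n * real l * (real d)\<^sup>2))
      = sqrt (real l / real n * ((real r)\<^sup>2 / (real n * real l * (real d)\<^sup>2)))"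
    by (simp only: real_sqrt_mult)
  also have "real l / real n * ((real r)\<^sup>2 / (real n * real l * (real d)\<^sup>2)) = (real r / (real n * real d))\<^sup>2"
    using assms by (simp add: field_simps power2_eq_square)
  finally show ?thesis by simp
qed

section \<open>The case l >= n, the general upper bound, and perfect squares\<close>

lemma eps_eq_1:
  assumes "0 < n" "n \<le> l"
  shows "eps n l = 1"
proof (rule antisym)
  have "real n / (real n * real 1) \<le> eps n l"
    using assms by (intro eps_ge_below) (auto simp: power2_eq_square)
  then show "1 \<le> eps n l" using assms by simp
  show "eps n l \<le> 1"
  proof (rule eps_leI)
    fix r d :: nat assume rd: "0 < r" "r \<le> n" "0 < d"
    have "r \<le> n * d" using rd mult_le_mono[of r n 1 d] by simp
    then have "real r \<le> real n * real d" by (metis of_nat_le_iff of_nat_mult)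
    then show "real r / (real n * real d) \<le> 1" by (cases "n = 0 \<or> d = 0") (auto simp: divide_le_eq_1)
  next
    fix r d :: nat assume rd: "0 < r" "r \<le> n" "0 < d" "n * l * d\<^sup>2 \<le> r\<^sup>2"
    \<comment> \<open>Aim at r (l d) <= r r and cancel r: enlarge r to n, insert one more factor d
      >= 1, then use n l d^2 <= r^2.\<close>
    have "r * (l * d) \<le> n * (l * d) * d" using rd(2,3) mult_le_mono[of "r * (l * d)" "n * (l * d)" 1 d] by simp
    also have "\<dots> \<le> r * r" using rd(4) by (simp add: power2_eq_square algebra_simps)
    finally have "l * d \<le> r" using rd(1) by simp
    then have "real d * real l \<le> real r" by (metis mult.commute of_nat_le_iff of_nat_mult)
    then show "real d * real l / real r \<le> 1" using rd(1) by simp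
  qed (use assms in auto)
qed

lemma eps_le_sqrt:
  assumes "0 < n" "0 < l"
  shows "eps n l \<le> sqrt (real l / real n)"
proof (rule eps_leI)
  fix r d :: nat assume rd: "0 < r" "r \<le> n" "0 < d" "r\<^sup>2 \<le> n * l * d\<^sup>2"
  have "(real r)\<^sup>2 \<le> real n * real l * (real d)\<^sup>2"
    using rd(4) by (metis of_nat_le_iff of_nat_mult of_nat_power)
  then have "(real r / (real n * real d))\<^sup>2 \<le> real l / real n"
    using rd assms by (simp add: field_simps power2_eq_square)
  then show "real r / (real n * real d) \<le> sqrt (real l / real n)"
    by (rule real_le_rsqrt)
next
  fix r d :: nat assume rd: "0 < r" "r \<le> n" "0 < d" "n * l * d\<^sup>2 \<le> r\<^sup>2"
  have "real n * real l * (real d)\<^sup>2 \<le> (real r)\<^sup>2"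
    using rd(4) by (metis of_nat_le_iff of_nat_mult of_nat_power)
  then have "real l * (real n * real l * (real d)\<^sup>2) \<le> real l * (real r)\<^sup>2"
    by (intro mult_left_mono) auto
  then have "(real d * real l / real r)\<^sup>2 \<le> real l / real n"
    using rd assms by (simp add: field_simps power2_eq_square)
  then show "real d * real l / real r \<le> sqrt (real l / real n)"
    by (rule real_le_rsqrt)
qed (use assms in auto)

text \<open>The root q of n l satisfies q <= n because l < n, so (q, 1) is an admissible pair that
  hits sqrt (n l) exactly and attains the bound \<open>eps_le_sqrt\<close>.\<close>

lemma eps_square:
  assumes "0 < l" "l < n" "is_square (n * l)"
  shows "eps n l = sqrt (real l / real n)"
proof (rule antisym)
  obtain q where q: "n * l = q\<^sup>2" using assms(3) by (auto elim: is_nth_powerE)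
  have "0 < q" using q assms by (cases q) auto
  have "q\<^sup>2 \<le> n\<^sup>2" using assms(1,2) unfolding q[symmetric] by (simp add: power2_eq_square)
  then have "q \<le> n" by simp
  have "real q / (real n * real 1) \<le> eps n l"
    using assms q \<open>0 < q\<close> \<open>q \<le> n\<close> by (intro eps_ge_below) auto
  also have "real q / (real n * real 1) = sqrt (real l / real n)"
  proof -
    have "real n * real l = (real q)\<^sup>2" using q by (metis of_nat_mult of_nat_power)
    then have "(real q / real n)\<^sup>2 = real l / real n"
      using assms by (simp add: field_simps power2_eq_square)
    then show ?thesis by (metis mult.right_neutral of_nat_0_le_iff of_nat_1 real_sqrt_unique zero_le_divide_iff)
  qed
  finally show "sqrt (real l / real n) \<le> eps n l" .
qed (use eps_le_sqrt assms in auto)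

section \<open>Norms 1 and -1\<close>

text \<open>The size estimate behind both Pell cases: a competitor's numerator has the form r A + N
  d B, and with A and B positive the second summand alone is at least N >= n, which violates r' <=
  n.\<close>

lemma unit_multiple_gt:
  fixes A B N n d r :: int
  assumes "0 < A" "0 < B" "0 < r" "0 < d" "0 < n" "n \<le> N"
  shows "n < r * A + N * d * B"
proof -
  have "1 \<le> d * B" using assms mult_pos_pos[of d B] by linarith
  then have "N * 1 \<le> N * (d * B)" using assms by (intro mult_left_mono) auto
  moreover have "0 < r * A" using assms by simp
  ultimately show ?thesis using assms(6) by (simp add: mult.assoc)
qed

text \<open>Dividing r' + d' sqrt N by the unit r + d sqrt N gives A + B sqrt N with A = r r' - N d
  d' and B = r d' - d r'. If r'/d' lies below sqrt N then B > 0, if above then A > 0. By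
  \<open>contra\<close> the other coefficient is then <= 0, and this is the desired bound for (r',
  d').\<close>

lemma eps_pell_pos:
  assumes "0 < n" "0 < l" "0 < r" "r \<le> n" "0 < d" and pell: "r\<^sup>2 = n * l * d\<^sup>2 + 1"
  shows "eps n l = real d * real l / real r"
proof (rule antisym)
  define N where "N = int n * int l"
  have N: "int n \<le> N" "0 < N" using assms by (simp_all add: N_def)
  have pell': "(int r)\<^sup>2 = N * (int d)\<^sup>2 + 1"
    using arg_cong[OF pell, of int] by (simp add: N_def)
  have contra: False
    if "r' \<le> n" and A: "0 < int r * int r' - N * int d * int d'"
      and B: "0 < int r * int d' - int d * int r'" for r' d'
  proof -
    \<comment> \<open>The right-hand side is r A + N d B, which collapses to (r^2 - N d^2) r' =
      r'.\<close>
    have "int n < int r * (int r * int r' - N * int d * int d') + N * int d * (int r * int d' - int d * int r')"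
      using assms N A B by (intro unit_multiple_gt) auto
    also have "\<dots> = ((int r)\<^sup>2 - N * (int d)\<^sup>2) * int r'"
      by (simp add: algebra_simps power2_eq_square)
    finally show False using pell' \<open>r' \<le> n\<close> by simp
  qed
  show "eps n l \<le> real d * real l / real r"
  proof (rule eps_leI)
    fix r' d' :: nat assume rd: "0 < r'" "r' \<le> n" "0 < d'" "r'\<^sup>2 \<le> n * l * d'\<^sup>2"
    have le: "(int r')\<^sup>2 \<le> N * (int d')\<^sup>2"
      using rd(4) unfolding N_def by (metis of_nat_le_iff of_nat_mult of_nat_power)
    have "(int d * int r')\<^sup>2 = (int d)\<^sup>2 * (int r')\<^sup>2" by (simp add: power_mult_distrib)
    also have "\<dots> \<le> (int d)\<^sup>2 * (N * (int d')\<^sup>2)" using le by (intro mult_left_mono) auto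
    also have "\<dots> < (N * (int d)\<^sup>2 + 1) * (int d')\<^sup>2" using rd by (simp add: algebra_simps)
    also have "\<dots> = (int r * int d')\<^sup>2" by (simp add: pell' power_mult_distrib)
    finally have "int d * int r' < int r * int d'" by (rule power_less_imp_less_base) auto
    with contra[OF rd(2), of d'] have "int r * int r' \<le> N * int d * int d'" by fastforce
    then have "real r * real r' \<le> real n * real l * real d * real d'"
      unfolding N_def by (metis of_nat_le_iff of_nat_mult)
    then show "real r' / (real n * real d') \<le> real d * real l / real r"
      using assms rd by (simp add: field_simps)
  next
    fix r' d' :: nat assume rd: "0 < r'" "r' \<le> n" "0 < d'" "n * l * d'\<^sup>2 \<le> r'\<^sup>2"
    have le: "N * (int d')\<^sup>2 \<le> (int r')\<^sup>2"
      using rd(4) unfolding N_def by (metis of_nat_le_iff of_nat_mult of_nat_power)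
    have "(N * int d * int d')\<^sup>2 = (N * (int d)\<^sup>2) * (N * (int d')\<^sup>2)" by (simp add: power2_eq_square)
    also have "\<dots> \<le> (N * (int d)\<^sup>2) * (int r')\<^sup>2" using le N by (intro mult_left_mono) auto
    also have "\<dots> < (N * (int d)\<^sup>2 + 1) * (int r')\<^sup>2" using rd by (simp add: algebra_simps)
    also have "\<dots> = (int r * int r')\<^sup>2" by (simp add: pell' power_mult_distrib)
    finally have "N * int d * int d' < int r * int r'" by (rule power_less_imp_less_base) auto
    with contra[OF rd(2), of d'] have "int r * int d' \<le> int d * int r'" by fastforce
    then have "real r * real d' \<le> real d * real r'" by (metis of_nat_le_iff of_nat_mult)
    then have "real l * (real r * real d') \<le> real l * (real d * real r')" by (intro mult_left_mono) auto
    then show "real d' * real l / real r' \<le> real d * real l / real r"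
      using assms rd by (simp add: field_simps)
  qed (use assms in auto)
  show "real d * real l / real r \<le> eps n l"
    using assms by (intro eps_ge_above) auto
qed

text \<open>The same division by a unit, now of norm -1, so both coefficients change sign: A = N d
  d' - r r' and B = d r' - r d'. The roles of the sides are exchanged as well: below sqrt N it is A
  that is positive, above it is B.\<close>

lemma eps_pell_neg:
  assumes "0 < n" "0 < l" "0 < r" "r \<le> n" "0 < d" and pell: "r\<^sup>2 + 1 = n * l * d\<^sup>2"
  shows "eps n l = real r / (real n * real d)"
proof (rule antisym)
  define N where "N = int n * int l"
  have N: "int n \<le> N" "0 < N" using assms by (simp_all add: N_def)
  have pell': "N * (int d)\<^sup>2 = (int r)\<^sup>2 + 1"
    using arg_cong[OF pell, of int] by (simp add: N_def)
  have contra: False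
    if "r' \<le> n" and A: "0 < N * int d * int d' - int r * int r'"
      and B: "0 < int d * int r' - int r * int d'" for r' d'
  proof -
    have "int n < int r * (N * int d * int d' - int r * int r') + N * int d * (int d * int r' - int r * int d')"
      using assms N A B by (intro unit_multiple_gt) auto
    also have "\<dots> = (N * (int d)\<^sup>2 - (int r)\<^sup>2) * int r'"
      by (simp add: algebra_simps power2_eq_square)
    finally show False using pell' \<open>r' \<le> n\<close> by simp
  qed
  show "eps n l \<le> real r / (real n * real d)"
  proof (rule eps_leI)
    fix r' d' :: nat assume rd: "0 < r'" "r' \<le> n" "0 < d'" "r'\<^sup>2 \<le> n * l * d'\<^sup>2"
    have le: "(int r')\<^sup>2 \<le> N * (int d')\<^sup>2"
      using rd(4) unfolding N_def by (metis of_nat_le_iff of_nat_mult of_nat_power)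
    have "(int r * int r')\<^sup>2 = (int r)\<^sup>2 * (int r')\<^sup>2" by (simp add: power_mult_distrib)
    also have "\<dots> \<le> (int r)\<^sup>2 * (N * (int d')\<^sup>2)" using le by (intro mult_left_mono) auto
    also have "\<dots> < ((int r)\<^sup>2 + 1) * (N * (int d')\<^sup>2)" using rd N by (simp add: algebra_simps)
    also have "\<dots> = (N * int d * int d')\<^sup>2"
      unfolding pell'[symmetric] by (simp add: power2_eq_square)
    finally have "int r * int r' < N * int d * int d'" 
      by (rule power_less_imp_less_base) (use N in auto)
    with contra[OF rd(2), of d'] have "int d * int r' \<le> int r * int d'" by fastforce
    then have "real d * real r' \<le> real r * real d'" by (metis of_nat_le_iff of_nat_mult)
    then show "real r' / (real n * real d') \<le> real r / (real n * real d)"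
      using assms rd by (simp add: field_simps)
  next
    fix r' d' :: nat assume rd: "0 < r'" "r' \<le> n" "0 < d'" "n * l * d'\<^sup>2 \<le> r'\<^sup>2"
    have le: "N * (int d')\<^sup>2 \<le> (int r')\<^sup>2"
      using rd(4) unfolding N_def by (metis of_nat_le_iff of_nat_mult of_nat_power)
    have "(int r * int d')\<^sup>2 = (int r)\<^sup>2 * (int d')\<^sup>2" by (simp add: power_mult_distrib)
    also have "\<dots> < ((int r)\<^sup>2 + 1) * (int d')\<^sup>2" using rd by (simp add: algebra_simps)
    also have "\<dots> = (int d)\<^sup>2 * (N * (int d')\<^sup>2)" by (simp flip: pell')
    also have "\<dots> \<le> (int d)\<^sup>2 * (int r')\<^sup>2" using le by (intro mult_left_mono) auto
    also have "\<dots> = (int d * int r')\<^sup>2" by (simp add: power_mult_distrib)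
    finally have "int r * int d' < int d * int r'" by (rule power_less_imp_less_base) auto
    with contra[OF rd(2), of d'] have "N * int d * int d' \<le> int r * int r'" by fastforce
    then have "real n * real l * real d * real d' \<le> real r * real r'"
      unfolding N_def by (metis of_nat_le_iff of_nat_mult)
    then show "real d' * real l / real r' \<le> real r / (real n * real d)"
      using assms rd by (simp add: field_simps)
  qed (use assms in auto)
  show "real r / (real n * real d) \<le> eps n l"
    using assms by (intro eps_ge_below) auto
qed

section \<open>A criterion for exceeding the threshold\<close>

text \<open>Squaring and clearing denominators turns "the element of (r, d) exceeds the threshold"
  into \<open>above\<close> when r/d >= sqrt (n l) and into \<open>below\<close> otherwise. Keeping
  the sides apart matters for small n, where \<open>above\<close> can hold although r^2 - n l d^2 is
  as large as l d^2.\<close>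

lemma eps_gt_if_close:
  assumes "0 < n" "0 < l" "0 < a" "0 < r" "r \<le> n" "0 < d"
    and above: "int a * int n * ((int r)\<^sup>2 - int n * int l * (int d)\<^sup>2) < (int r)\<^sup>2"
    and below: "int a * (int n * int l * (int d)\<^sup>2 - (int r)\<^sup>2) < int l * (int d)\<^sup>2"
  shows "sqrt (real l / real n) * sqrt (1 - 1 / (real a * real n)) < eps n l"
proof -
  let ?t = "real l / real n * (1 - 1 / (real a * real n))"
  have "1 \<le> a * n" using assms by simp
  then have "1 \<le> real a * real n" by (metis of_nat_1 of_nat_le_iff of_nat_mult)
  then have t: "0 \<le> ?t" by (simp add: divide_le_eq_1)
  show ?thesis
  proof (cases "n * l * d\<^sup>2 \<le> r\<^sup>2")
    case True
    have "real_of_int (int a * int n * ((int r)\<^sup>2 - int n * int l * (int d)\<^sup>2)) < real_of_int ((int r)\<^sup>2)"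
      using above by linarith
    then have "(real a * real n - 1) * (real r)\<^sup>2 < real a * real n * real n * real l * (real d)\<^sup>2"
      by (simp add: algebra_simps)
    then have "real l * ((real a * real n - 1) * (real r)\<^sup>2) < real l * (real a * real n * real n * real l * (real d)\<^sup>2)"
      using assms(2) by (intro mult_strict_left_mono) auto
    then have "?t < (real d * real l / real r)\<^sup>2"
      using assms by (simp add: field_simps power2_eq_square)
    then have "sqrt ?t < real d * real l / real r"
      using t by (intro real_less_lsqrt) auto
    also have "\<dots> \<le> eps n l" using assms True by (intro eps_ge_above) auto
    finally show ?thesis by (simp only: real_sqrt_mult)
  next
    case False
    have "real_of_int (int a * (int n * int l * (int d)\<^sup>2 - (int r)\<^sup>2)) < real_of_int (int l * (int d)\<^sup>2)"
      using below by linarith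
    then have "(real a * real n - 1) * (real l * (real d)\<^sup>2) < real a * (real r)\<^sup>2"
      by (simp add: algebra_simps)
    then have "(real a * real n - 1) * (real l * (real d)\<^sup>2) / (real a * (real n)\<^sup>2 * (real d)\<^sup>2)
        < real a * (real r)\<^sup>2 / (real a * (real n)\<^sup>2 * (real d)\<^sup>2)"
      using assms by (intro divide_strict_right_mono) auto
    also have "\<dots> = (real r / (real n * real d))\<^sup>2"
      using assms by (simp add: power_mult_distrib power_divide)
    also have "(real a * real n - 1) * (real l * (real d)\<^sup>2) / (real a * (real n)\<^sup>2 * (real d)\<^sup>2) = ?t"
      using assms by (simp add: field_simps power2_eq_square)
    finally have "?t < (real r / (real n * real d))\<^sup>2" .
    then have "sqrt ?t < real r / (real n * real d)"
      using t by (intro real_less_lsqrt) auto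
    also have "\<dots> \<le> eps n l" using assms False by (intro eps_ge_below) auto
    finally show ?thesis by (simp only: real_sqrt_mult)
  qed
qed

text \<open>A symmetric form suited to Dirichlet approximation. For positive
  \<open>?\<delta>\<close>, multiplying the hypothesis by n gives a n \<open>?\<delta>\<close> < n l
  d^2 < r^2, which is the condition \<open>above\<close>.\<close>

lemma eps_gt_if_norm_small:
  assumes "0 < n" "0 < l" "0 < a" "0 < r" "r \<le> n" "0 < d"
    and close: "int a * \<bar>(int r)\<^sup>2 - int n * int l * (int d)\<^sup>2\<bar> < int l * (int d)\<^sup>2"
  shows "sqrt (real l / real n) * sqrt (1 - 1 / (real a * real n)) < eps n l"
proof (rule eps_gt_if_close[OF assms(1-6)])
  let ?\<delta> = "(int r)\<^sup>2 - int n * int l * (int d)\<^sup>2"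
  have "int a * (- ?\<delta>) \<le> int a * \<bar>?\<delta>\<bar>" by (intro mult_left_mono) auto
  then show "int a * (int n * int l * (int d)\<^sup>2 - (int r)\<^sup>2) < int l * (int d)\<^sup>2"
    using close by simp
  show "int a * int n * ?\<delta> < (int r)\<^sup>2"
  proof (cases "?\<delta> \<le> 0")
    case True
    then have "int a * int n * ?\<delta> \<le> 0" by (intro mult_nonneg_nonpos) auto
    also have "0 < (int r)\<^sup>2" using assms by simp
    finally show ?thesis .
  next
    case False
    then have "int n * (int a * ?\<delta>) < int n * (int l * (int d)\<^sup>2)"
      using close assms by (intro mult_strict_left_mono) auto
    with False show ?thesis by (simp add: mult.assoc mult.left_commute)
  qed
qed

section \<open>Dirichlet approximation\<close>

lemma dirichlet_approx_closed:
  fixes q :: real and s :: nat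
  assumes "0 < s"
  obtains d :: nat and r :: int where "0 < d" "d \<le> s" "\<bar>real d * q - real_of_int r\<bar> \<le> 1 / real (s + 1)"
proof -
  \<comment> \<open>Adding the point 1 to the \<open>s + 1\<close> fractional parts gives the bound \<open>1 / (s + 1)\<close> already with \<open>d \<le> s\<close>.\<close>
  define g where "g i = (if i = Suc s then 1 else frac (real i * q))" for i
  \<comment> \<open>The \<open>min\<close> puts the point 1 into the last box instead of a new one.
    The s + 2 points thus share s + 1 closed boxes of length 1/(s + 1).\<close>
  define box where "box i = min s (nat \<lfloor>real (s + 1) * g i\<rfloor>)" for i
  have g: "0 \<le> g i" "g i \<le> 1" for i
    by (simp_all add: g_def frac_ge_0 frac_lt_1 less_imp_le)
  have box: "real (box i) \<le> real (s + 1) * g i \<and> real (s + 1) * g i \<le> real (box i) + 1" for i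
  proof (cases "nat \<lfloor>real (s + 1) * g i\<rfloor> \<le> s")
    case True
    have "0 \<le> real (s + 1) * g i" using g by simp
    with True show ?thesis unfolding box_def by (simp add: min_def) linarith
  next
    case False
    then have "box i = s" "real s \<le> real (s + 1) * g i" by (simp_all add: box_def) linarith
    moreover have "real (s + 1) * g i \<le> real s + 1"
    proof -
      have "real (s + 1) * g i \<le> real (s + 1) * 1" by (rule mult_left_mono) (use g in auto)
      then show ?thesis by (simp only: of_nat_add of_nat_1 mult_1_right)
    qed
    ultimately show ?thesis by metis
  qed
  have same_box: "\<bar>g j - g i\<bar> \<le> 1 / real (s + 1)" if "box i = box j" for i j
  proof -
    have "real (s + 1) * \<bar>g j - g i\<bar> = \<bar>real (s + 1) * g j - real (s + 1) * g i\<bar>"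
      by (simp add: abs_mult flip: right_diff_distrib)
    also have "\<dots> \<le> 1" using box[of i] box[of j] that by linarith
    finally show ?thesis by (simp add: field_simps)
  qed
  have "\<not> inj_on box {..Suc s}"
  proof (rule pigeonhole)
    have "box ` {..Suc s} \<subseteq> {..s}" by (auto simp: box_def)
    then have "card (box ` {..Suc s}) \<le> card {..s}" by (rule card_mono[rotated]) simp
    then show "card (box ` {..Suc s}) < card {..Suc s}" by simp
  qed
  then obtain i j where ij: "i < j" "j \<le> Suc s" "box i = box j"
    unfolding inj_on_def by (metis atMost_iff linorder_neqE_nat)
  show thesis
  proof (cases "j = Suc s")
    case False
    show thesis
    proof (rule that)
      show "0 < j - i" "j - i \<le> s" using ij False by auto
      have "real (j - i) * q - real_of_int (\<lfloor>real j * q\<rfloor> - \<lfloor>real i * q\<rfloor>) = g j - g i"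
        using ij False by (simp add: g_def frac_def of_nat_diff algebra_simps)
      then show "\<bar>real (j - i) * q - real_of_int (\<lfloor>real j * q\<rfloor> - \<lfloor>real i * q\<rfloor>)\<bar> \<le> 1 / real (s + 1)"
        using same_box[OF ij(3)] by simp
    qed
  next
    case True
    \<comment> \<open>The points 0 and 1 lie in different boxes as s > 0, so a partner of the added
      point 1 has a positive index, which serves as denominator.\<close>
    have "box 0 = 0" "box (Suc s) = s" by (simp_all add: box_def g_def nat_add_distrib)
    with True ij assms have "0 < i" by (cases i) auto
    show thesis
    proof (rule that)
      show "0 < i" "i \<le> s" using ij True \<open>0 < i\<close> by auto
      have "real i * q - real_of_int (\<lfloor>real i * q\<rfloor> + 1) = - (g j - g i)"
        using ij True by (simp add: g_def frac_def)
      then show "\<bar>real i * q - real_of_int (\<lfloor>real i * q\<rfloor> + 1)\<bar> \<le> 1 / real (s + 1)"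
        using same_box[OF ij(3)] by simp
    qed
  qed
qed

text \<open>With e = 1/(s + 1), the norm is at most e (2 d q + e), whereas q < (s + 1) l alone would
  only give 2 d l + e^2. Integrality of n pushes q below (s + 1) l - e/2, and this gap absorbs the
  extra e.\<close>

lemma norm_form_less:
  assumes "0 < s" "0 < l" "s\<^sup>2 * l \<le> n" "n < (s + 1)\<^sup>2 * l" "0 < d"
    and q: "q = sqrt (real n * real l)"
    and approx: "\<bar>real d * q - real r\<bar> \<le> 1 / real (s + 1)"
  shows "\<bar>(int r)\<^sup>2 - int n * int l * (int d)\<^sup>2\<bar> < 2 * int d * int l"
proof -
  let ?e = "1 / real (s + 1)"
  have q2: "q\<^sup>2 = real n * real l" and q0: "0 \<le> q" by (simp_all add: q)
  have "n + 1 \<le> (s + 1)\<^sup>2 * l" using assms by simp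
  then have "real n + 1 \<le> (real (s + 1))\<^sup>2 * real l"
    by (metis of_nat_1 of_nat_add of_nat_le_iff of_nat_mult of_nat_power)
  then have "(real n + 1) * real l \<le> (real (s + 1))\<^sup>2 * real l * real l"
    by (intro mult_right_mono) auto
  then have "q\<^sup>2 \<le> (real (s + 1) * real l)\<^sup>2 - real l"
    unfolding q2 by (simp add: power2_eq_square algebra_simps)
  also have "\<dots> < (real (s + 1) * real l)\<^sup>2 - real l + (?e / 2)\<^sup>2"
    by simp
  \<comment> \<open>Completing the square: for x = (s + 1) l the subtracted l equals x e.\<close>
  also have "\<dots> = (real (s + 1) * real l - ?e / 2)\<^sup>2"
  proof -
    have "real (s + 1) * real l * ?e = real l" by simp
    moreover have "(x - e / 2)\<^sup>2 = x\<^sup>2 - x * e + (e / 2)\<^sup>2" for x e :: real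
      by (simp add: power2_eq_square field_simps)
    ultimately show ?thesis by (simp only:)
  qed
  finally have "q\<^sup>2 < (real (s + 1) * real l - ?e / 2)\<^sup>2" .
  moreover have "0 \<le> real (s + 1) * real l - ?e / 2"
  proof -
    have "1 \<le> (s + 1) * l" using assms by simp
    then have "1 \<le> real (s + 1) * real l" by (metis of_nat_1 of_nat_le_iff of_nat_mult)
    moreover have "?e \<le> 1" by simp
    moreover have "0 \<le> x - e / 2" if "1 \<le> x" "e \<le> 1" for x e :: real using that by simp
    ultimately show ?thesis by blast
  qed
  ultimately have "q < real (s + 1) * real l - ?e / 2"
    by (rule power_less_imp_less_base)
  have aux: "2 * c * q + e < 2 * c * x" if "2 * c * q < 2 * c * (x - e / 2)" "e \<le> c * e" for c x e :: real
    using that by (simp add: algebra_simps)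
  from \<open>q < _\<close> have "2 * real d * q < 2 * real d * (real (s + 1) * real l - ?e / 2)"
    using assms by (intro mult_strict_left_mono) auto
  moreover have "?e \<le> real d * ?e" using assms by (simp add: divide_right_mono)
  ultimately have dq: "2 * real d * q + ?e < 2 * real d * (real (s + 1) * real l)"
    by (rule aux)
  have "\<bar>(real r)\<^sup>2 - (real d * q)\<^sup>2\<bar> = \<bar>real d * q - real r\<bar> * (real d * q + real r)"
  proof -
    have "(real r)\<^sup>2 - (real d * q)\<^sup>2 = - ((real d * q - real r) * (real d * q + real r))"
      by (simp add: power2_eq_square algebra_simps)
    then show ?thesis using q0 by (simp add: abs_mult)
  qed
  also have "\<dots> \<le> ?e * (2 * real d * q + ?e)"
    using approx q0 by (intro mult_mono) (auto simp: abs_le_iff mult.commute)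
  also have "\<dots> < ?e * (2 * real d * (real (s + 1) * real l))"
    using dq by (intro mult_strict_left_mono) auto
  also have "\<dots> = 2 * real d * real l" by simp
  finally have "\<bar>(real r)\<^sup>2 - real n * real l * (real d)\<^sup>2\<bar> < 2 * real d * real l"
    by (simp add: power_mult_distrib q2 mult.commute)
  then have "real_of_int \<bar>(int r)\<^sup>2 - int n * int l * (int d)\<^sup>2\<bar> < real_of_int (2 * int d * int l)"
    by simp
  then show ?thesis by linarith
qed

text \<open>Adds admissibility to Dirichlet's theorem. The lower end s^2 l <= n of the range gives s
  q <= n, hence d q <= n, and as the error is below 1, r <= n. Positivity of r follows likewise from
  d q >= 1.\<close>

lemma good_approx:
  assumes "0 < s" "0 < l" "s\<^sup>2 * l \<le> n" "n < (s + 1)\<^sup>2 * l"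
  obtains d r :: nat where "0 < d" "d \<le> s" "0 < r" "r \<le> n"
    "\<bar>real d * sqrt (real n * real l) - real r\<bar> \<le> 1 / real (s + 1)"
    "\<bar>(int r)\<^sup>2 - int n * int l * (int d)\<^sup>2\<bar> < 2 * int d * int l"
proof -
  define q where "q = sqrt (real n * real l)"
  have "0 < s\<^sup>2 * l" using assms(1,2) by simp
  then have "0 < n" using assms(3) by linarith
  have "1 \<le> n * l" using assms \<open>0 < n\<close> by simp
  then have q1: "1 \<le> q" unfolding q_def by (metis of_nat_1 of_nat_le_iff of_nat_mult real_sqrt_ge_1_iff)
  obtain d :: nat and z :: int where dz: "0 < d" "d \<le> s" "\<bar>real d * q - real_of_int z\<bar> \<le> 1 / real (s + 1)"
    using dirichlet_approx_closed[OF assms(1), of q] by blast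
  have e: "1 / real (s + 1) < 1" using assms by simp
  have "1 * 1 \<le> real d * q" using dz(1) q1 by (intro mult_mono) auto
  then have "0 < real_of_int z" using dz(3) e by linarith
  then obtain r where r: "z = int r" "0 < r"
    by (metis of_int_0_less_iff zero_less_imp_eq_int)
  have "real s * q \<le> real n"
  proof -
    have "n * (s\<^sup>2 * l) \<le> n * n" using assms by simp
    then have "s\<^sup>2 * (n * l) \<le> n\<^sup>2" by (simp add: power2_eq_square algebra_simps)
    then have "(real s)\<^sup>2 * (real n * real l) \<le> (real n)\<^sup>2"
      by (metis of_nat_le_iff of_nat_mult of_nat_power)
    then have "(real s * q)\<^sup>2 \<le> (real n)\<^sup>2" by (simp add: q_def power_mult_distrib)
    then show ?thesis by (rule power2_le_imp_le) simp
  qed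
  moreover have "real d * q \<le> real s * q" using dz(2) q1 by (intro mult_right_mono) auto
  ultimately have "real r < real n + 1" using dz(3) e r by linarith
  then have "r \<le> n" by linarith
  have "\<bar>real d * q - real r\<bar> \<le> 1 / real (s + 1)" using dz(3) r by simp
  with that dz(1,2) r(2) \<open>r \<le> n\<close> norm_form_less[OF assms dz(1) q_def] q_def show thesis by blast
qed

section \<open>Part (c): l = 1\<close>

lemma eps_one_gt:
  assumes "0 < n" "\<not> is_square (n + 1)" "\<not> is_square (n - 1)"
  shows "1 / sqrt (real n + 1) < eps n 1"
proof -
  define s where "s = floor_sqrt n"
  have s: "s\<^sup>2 * 1 \<le> n" "n < (s + 1)\<^sup>2 * 1"
    using floor_sqrt_power2_le[of n] Suc_floor_sqrt_power2_gt[of n] by (simp_all add: s_def)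
  have "0 < s" using assms by (simp add: s_def)
  obtain d r :: nat where dr: "0 < d" "d \<le> s" "0 < r" "r \<le> n"
    "\<bar>(int r)\<^sup>2 - int n * int 1 * (int d)\<^sup>2\<bar> < 2 * int d * int 1"
    using good_approx[OF \<open>0 < s\<close> _ s] by (metis zero_less_one)
  have "d\<^sup>2 \<le> s\<^sup>2" using dr(2) by simp
  then have dn: "d\<^sup>2 \<le> n" using s(1) by linarith
  \<comment> \<open>For d >= 2 this follows from 2 d <= d^2. For d = 1 the norm is -1, 0 or 1, and
    the non-squareness of n + 1 and n - 1 leaves only 0.\<close>
  have \<delta>: "\<bar>(int r)\<^sup>2 - int n * (int d)\<^sup>2\<bar> < (int d)\<^sup>2"
  proof (cases "d = 1")
    case True
    have "r\<^sup>2 \<noteq> n + 1" "r\<^sup>2 \<noteq> n - 1" using assms by (metis is_nth_power_nth_power)+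
    then have "int (r\<^sup>2) \<noteq> int n + 1" "int (r\<^sup>2) \<noteq> int n - 1" using assms(1) by linarith+
    moreover have "\<bar>int (r\<^sup>2) - int n\<bar> < 2" using dr(5) True by simp
    ultimately have "int (r\<^sup>2) = int n" by linarith
    then have n: "n = r\<^sup>2" by linarith
    show ?thesis unfolding n using True by simp
  next
    case False
    then have "2 * int d \<le> int d * int d" using dr(1) by (intro mult_right_mono) auto
    then show ?thesis using dr(5) by (simp add: power2_eq_square)
  qed
  have "1 / (real n + 1) < (eps n 1)\<^sup>2"
  proof (cases "n * 1 * d\<^sup>2 \<le> r\<^sup>2")
    case True
    have "(int r)\<^sup>2 < int n * (int d)\<^sup>2 + (int d)\<^sup>2" using \<delta> by linarith
    then have "real_of_int ((int r)\<^sup>2) < real_of_int (int n * (int d)\<^sup>2 + (int d)\<^sup>2)" by linarith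
    then have "1 / (real n + 1) < (real d * real 1 / real r)\<^sup>2"
      using dr by (simp add: field_simps)
    also have "\<dots> \<le> (eps n 1)\<^sup>2"
      using assms dr True by (intro power_mono eps_ge_above) auto
    finally show ?thesis .
  next
    case False
    \<comment> \<open>The integer form with + 1 is essential: multiplied by n + 1 it yields (n + 1)
      r^2 >= n^2 d^2 + (n + 1 - d^2), and d^2 <= n makes the last term positive.\<close>
    have "int n * (int d)\<^sup>2 + 1 \<le> (int r)\<^sup>2 + (int d)\<^sup>2" using \<delta> by linarith
    then have "real_of_int (int n * (int d)\<^sup>2 + 1) \<le> real_of_int ((int r)\<^sup>2 + (int d)\<^sup>2)" by linarith
    then have "(real n + 1) * (real n * (real d)\<^sup>2 + 1) \<le> (real n + 1) * ((real r)\<^sup>2 + (real d)\<^sup>2)"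
      by (intro mult_left_mono) auto
    moreover have "real (d\<^sup>2) \<le> real n" using dn by (simp only: of_nat_le_iff)
    ultimately have "(real n)\<^sup>2 * (real d)\<^sup>2 < (real n + 1) * (real r)\<^sup>2"
      by (simp add: algebra_simps power2_eq_square)
    then have "1 / (real n + 1) < (real r / (real n * real d))\<^sup>2"
      using dr assms by (simp add: field_simps)
    also have "\<dots> \<le> (eps n 1)\<^sup>2"
      using assms dr False by (intro power_mono eps_ge_below) auto
    finally show ?thesis .
  qed
  moreover have "0 \<le> eps n 1"
    \<comment> \<open>The pair (n, 1) contributes 1/n, so \<open>eps n 1\<close> is nonnegative and
      the squared inequality may be rooted.\<close>
    using eps_ge_above[of n 1 n 1] assms by (simp add: power2_eq_square) (smt (verit) of_nat_0_le_iff zero_le_divide_1_iff)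
  ultimately show ?thesis
    by (metis real_sqrt_less_iff real_sqrt_divide real_sqrt_one real_sqrt_abs abs_of_nonneg)
qed

lemma threshold_one:
  assumes "0 < n"
  shows "sqrt (1 / real n) * sqrt (1 - 1 / real n) < 1 / sqrt (real n + 1)"
proof -
  have "1 / real n * (1 - 1 / real n) < 1 / (real n + 1)"
    using assms by (simp add: field_simps)
  then have "sqrt (1 / real n * (1 - 1 / real n)) < sqrt (1 / (real n + 1))" by simp
  then show ?thesis by (simp only: real_sqrt_mult real_sqrt_divide real_sqrt_one)
qed

section \<open>Counting failures for fixed l\<close>

lemma card_nat_near_le:
  fixes c w :: real
  assumes "2 * w \<le> real k"
  shows "finite {n::nat. \<bar>real n - c\<bar> < w}" "card {n::nat. \<bar>real n - c\<bar> < w} \<le> k"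
proof -
  let ?m = "\<lfloor>c - w\<rfloor> + 1"
  have sub: "{n::nat. \<bar>real n - c\<bar> < w} \<subseteq> nat ` {?m..<?m + int k}"
  proof
    fix n :: nat assume "n \<in> {n::nat. \<bar>real n - c\<bar> < w}"
    then have n: "c - w < real n" "real n < c + w" by (simp_all add: abs_less_iff)
    have "?m \<le> int n" using n(1) by linarith
    moreover have "int n < ?m + int k" using n(2) assms by linarith
    ultimately show "n \<in> nat ` {?m..<?m + int k}"
      by (intro image_eqI[of _ _ "int n"]) auto
  qed
  show "finite {n::nat. \<bar>real n - c\<bar> < w}" by (rule finite_subset[OF sub]) simp
  have "card {n::nat. \<bar>real n - c\<bar> < w} \<le> card (nat ` {?m..<?m + int k})"
    by (rule card_mono[OF _ sub]) simp
  also have "\<dots> \<le> card {?m..<?m + int k}" by (rule card_image_le) simp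
  finally show "card {n::nat. \<bar>real n - c\<bar> < w} \<le> k" by simp
qed

definition failing :: "nat \<Rightarrow> nat \<Rightarrow> nat \<Rightarrow> nat set" where
  "failing l a s = {n. s\<^sup>2 * l \<le> n \<and> n < (s + 1)\<^sup>2 * l \<and>
     \<not> eps n l > sqrt (real l / real n) * sqrt (1 - 1 / (real a * real n))}"

text \<open>For a failing n the pair from \<open>good_approx\<close> must have d < 2 a, and dividing
  its norm bound by l d^2 places n within 2/d of r^2/(l d^2). Values of r at or beyond d s l and d
  (s + 1) l force n to be next to an end of the range, which accounts for the three separate
  points.\<close>

lemma failing_subset:
  assumes "0 < s" "0 < l" "0 < a"
  shows "failing l a s \<subseteq> {s\<^sup>2 * l, s\<^sup>2 * l + 1, (s + 1)\<^sup>2 * l - 1} \<union>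
    (\<Union>d\<in>{1..<2 * a}. \<Union>r\<in>{d * (s * l)<..<d * ((s + 1) * l)}.
       {n. \<bar>real n - (real r)\<^sup>2 / (real l * (real d)\<^sup>2)\<bar> < 2 / real d})"
proof
  fix n assume "n \<in> failing l a s"
  then have n: "s\<^sup>2 * l \<le> n" "n < (s + 1)\<^sup>2 * l"
    and bad: "\<not> eps n l > sqrt (real l / real n) * sqrt (1 - 1 / (real a * real n))"
    by (auto simp: failing_def)
  define q where "q = sqrt (real n * real l)"
  have "0 < s\<^sup>2 * l" using assms by simp
  then have "0 < n" using n(1) by linarith
  obtain d r :: nat where dr: "0 < d" "d \<le> s" "0 < r" "r \<le> n"
    "\<bar>real d * q - real r\<bar> \<le> 1 / real (s + 1)"
    and norm: "\<bar>(int r)\<^sup>2 - int n * int l * (int d)\<^sup>2\<bar> < 2 * int d * int l"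
    using good_approx[OF assms(1,2) n] unfolding q_def by metis
  have "d < 2 * a"
  proof (rule ccontr)
    assume "\<not> d < 2 * a"
    have "int a * \<bar>(int r)\<^sup>2 - int n * int l * (int d)\<^sup>2\<bar> < int a * (2 * int d * int l)"
      using norm assms by (intro mult_strict_left_mono) auto
    also have "\<dots> = 2 * int a * (int d * int l)" by simp
    also have "\<dots> \<le> int d * (int d * int l)"
      using \<open>\<not> d < 2 * a\<close> by (intro mult_right_mono) auto
    also have "\<dots> = int l * (int d)\<^sup>2" by (simp add: power2_eq_square)
    finally show False
      using eps_gt_if_norm_small[OF \<open>0 < n\<close> assms(2,3) dr(3,4,1)] bad by simp
  qed
  have d1: "1 \<le> real d" using dr(1) by simp
  consider "r \<le> d * (s * l)" | "d * ((s + 1) * l) \<le> r" | "d * (s * l) < r" "r < d * ((s + 1) * l)"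
    by linarith
  then show "n \<in> {s\<^sup>2 * l, s\<^sup>2 * l + 1, (s + 1)\<^sup>2 * l - 1} \<union>
    (\<Union>d\<in>{1..<2 * a}. \<Union>r\<in>{d * (s * l)<..<d * ((s + 1) * l)}.
       {n. \<bar>real n - (real r)\<^sup>2 / (real l * (real d)\<^sup>2)\<bar> < 2 / real d})"
  proof cases
    case 1
    \<comment> \<open>Here r <= d s l <= d q, so d (q - s l) is within the error bound, and so is q
      - s l. Thus (s l, 1) is itself a good pair, and its norm l (l s^2 - n) is below 2 l in
      absolute value.\<close>
    have "s\<^sup>2 * l * l \<le> n * l" using n by simp
    then have "(s * l)\<^sup>2 \<le> n * l" by (simp add: power2_eq_square algebra_simps)
    then have "(real (s * l))\<^sup>2 \<le> real n * real l" by (metis of_nat_le_iff of_nat_mult of_nat_power)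
    then have ge: "real (s * l) \<le> q" unfolding q_def by (rule real_le_rsqrt)
    have "real r \<le> real d * real (s * l)" using 1 by (metis of_nat_le_iff of_nat_mult)
    moreover have "1 * (q - real (s * l)) \<le> real d * (q - real (s * l))"
      using ge d1 by (intro mult_right_mono) auto
    ultimately have "\<bar>real 1 * q - real (s * l)\<bar> \<le> 1 / real (s + 1)"
      using dr(5) ge by (simp add: right_diff_distrib)
    from norm_form_less[OF assms(1,2) n _ q_def this]
    have "\<bar>int l * (int l * (int s)\<^sup>2 - int n)\<bar> < int l * 2"
      by (simp add: power2_eq_square algebra_simps)
    then have "\<bar>int l * (int s)\<^sup>2 - int n\<bar> < 2" using assms by (simp add: abs_mult)
    then have "int n < int (s\<^sup>2 * l) + 2" by (simp add: mult.commute)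
    then have "n = s\<^sup>2 * l \<or> n = s\<^sup>2 * l + 1" using n(1) by linarith
    then show ?thesis by blast
  next
    case 2
    \<comment> \<open>Mirror image with the pair ((s + 1) l, 1). The end (s + 1)^2 l is outside the
      range, so only one value of n remains.\<close>
    have "n * l \<le> (s + 1)\<^sup>2 * l * l" using n by simp
    then have "n * l \<le> ((s + 1) * l)\<^sup>2" by (simp add: power2_eq_square algebra_simps)
    then have "real n * real l \<le> (real ((s + 1) * l))\<^sup>2" by (metis of_nat_le_iff of_nat_mult of_nat_power)
    then have le: "q \<le> real ((s + 1) * l)" unfolding q_def by (intro real_le_lsqrt) auto
    have "real d * real ((s + 1) * l) \<le> real r" using 2 by (metis of_nat_le_iff of_nat_mult)
    moreover have "1 * (real ((s + 1) * l) - q) \<le> real d * (real ((s + 1) * l) - q)"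
      using le d1 by (intro mult_right_mono) auto
    ultimately have "\<bar>real 1 * q - real ((s + 1) * l)\<bar> \<le> 1 / real (s + 1)"
      using dr(5) le unfolding right_diff_distrib by linarith
    from norm_form_less[OF assms(1,2) n _ q_def this]
    have "\<bar>int l * (int l * (int s + 1)\<^sup>2 - int n)\<bar> < int l * 2"
      by (simp add: power2_eq_square algebra_simps)
    then have "\<bar>int l * (int s + 1)\<^sup>2 - int n\<bar> < 2" using assms by (simp add: abs_mult)
    then have "int ((s + 1)\<^sup>2 * l) < int n + 2" by (simp add: mult.commute add.commute)
    then have "n = (s + 1)\<^sup>2 * l - 1" using n(2) by linarith
    then show ?thesis by blast
  next
    case 3
    have "real_of_int \<bar>(int r)\<^sup>2 - int n * int l * (int d)\<^sup>2\<bar> < real_of_int (2 * int d * int l)"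
      using norm by linarith
    then have "\<bar>(real r)\<^sup>2 - real n * real l * (real d)\<^sup>2\<bar> / (real l * (real d)\<^sup>2)
        < 2 * real d * real l / (real l * (real d)\<^sup>2)"
      using assms dr by (intro divide_strict_right_mono) auto
    also have "\<dots> = 2 / real d" using assms dr by (simp add: power2_eq_square)
    also have "\<bar>(real r)\<^sup>2 - real n * real l * (real d)\<^sup>2\<bar> / (real l * (real d)\<^sup>2)
        = \<bar>((real r)\<^sup>2 - real n * real l * (real d)\<^sup>2) / (real l * (real d)\<^sup>2)\<bar>"
      by (simp add: abs_mult)
    also have "((real r)\<^sup>2 - real n * real l * (real d)\<^sup>2) / (real l * (real d)\<^sup>2)
        = - (real n - (real r)\<^sup>2 / (real l * (real d)\<^sup>2))"
      using assms dr by (simp add: field_simps)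
    finally have "\<bar>real n - (real r)\<^sup>2 / (real l * (real d)\<^sup>2)\<bar> < 2 / real d" by simp
    with 3 \<open>d < 2 * a\<close> dr(1) show ?thesis
      by (intro UnI2 UN_I[of d] UN_I[of r]) auto
  qed
qed

text \<open>An open interval of length \<open>4 / d\<close> contains at most this many integers.\<close>

definition mult_bound :: "nat \<Rightarrow> nat" where
  "mult_bound d = (if d = 1 then 4 else if d \<le> 3 then 2 else 1)"

text \<open>Three end values, and for each d the d l - 1 integers r strictly between d s l and d (s
  + 1) l, each accounting for at most \<open>mult_bound d\<close> values of n. The bound does not
  depend on s.\<close>

lemma card_failing_le:
  assumes "0 < s" "0 < l" "0 < a"
  shows "card (failing l a s) \<le> 3 + (\<Sum>d\<in>{1..<2 * a}. (d * l - 1) * mult_bound d)"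
proof -
  define near where "near d r = {n::nat. \<bar>real n - (real r)\<^sup>2 / (real l * (real d)\<^sup>2)\<bar> < 2 / real d}"
    for d r :: nat
  define E where "E = {s\<^sup>2 * l, s\<^sup>2 * l + 1, (s + 1)\<^sup>2 * l - 1}"
  have near: "finite (near d r) \<and> card (near d r) \<le> mult_bound d" if "1 \<le> d" for d r
  proof -
    have "2 * (2 / real d) \<le> real (mult_bound d)"
    proof -
      have "2 \<le> d \<Longrightarrow> d \<le> 3 \<Longrightarrow> d = 2 \<or> d = 3" by linarith
      then show ?thesis using that by (auto simp: mult_bound_def divide_le_eq)
    qed
    then show ?thesis unfolding near_def using card_nat_near_le by blast
  qed
  have "card (failing l a s) \<le> card (E \<union> (\<Union>d\<in>{1..<2 * a}. \<Union>r\<in>{d * (s * l)<..<d * ((s + 1) * l)}. near d r))"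
  proof (rule card_mono)
    show "finite (E \<union> (\<Union>d\<in>{1..<2 * a}. \<Union>r\<in>{d * (s * l)<..<d * ((s + 1) * l)}. near d r))"
      using near by (simp add: E_def)
  qed (use failing_subset[OF assms] in \<open>unfold near_def E_def\<close>)
  also have "\<dots> \<le> card E + card (\<Union>d\<in>{1..<2 * a}. \<Union>r\<in>{d * (s * l)<..<d * ((s + 1) * l)}. near d r)"
    by (rule card_Un_le)
  also have "card E \<le> 3"
    using card_length[of "[s\<^sup>2 * l, s\<^sup>2 * l + 1, (s + 1)\<^sup>2 * l - 1]"] by (simp add: E_def)
  also have "card (\<Union>d\<in>{1..<2 * a}. \<Union>r\<in>{d * (s * l)<..<d * ((s + 1) * l)}. near d r)
      \<le> (\<Sum>d\<in>{1..<2 * a}. card (\<Union>r\<in>{d * (s * l)<..<d * ((s + 1) * l)}. near d r))"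
    by (rule card_UN_le) simp
  also have "\<dots> \<le> (\<Sum>d\<in>{1..<2 * a}. (d * l - 1) * mult_bound d)"
  proof (rule sum_mono)
    fix d assume d: "d \<in> {1..<2 * a}"
    have "card (\<Union>r\<in>{d * (s * l)<..<d * ((s + 1) * l)}. near d r)
        \<le> (\<Sum>r\<in>{d * (s * l)<..<d * ((s + 1) * l)}. card (near d r))"
      by (rule card_UN_le) simp
    also have "\<dots> \<le> (\<Sum>r\<in>{d * (s * l)<..<d * ((s + 1) * l)}. mult_bound d)"
      using d near by (intro sum_mono) auto
    also have "\<dots> = (d * l - 1) * mult_bound d"
      by (simp add: algebra_simps)
    finally show "card (\<Union>r\<in>{d * (s * l)<..<d * ((s + 1) * l)}. near d r) \<le> (d * l - 1) * mult_bound d" .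
  qed
  finally show ?thesis by simp
qed

text \<open>The source of the coefficient 2 a^2 - a + 8, with a moved to the left to avoid
  subtraction of naturals. At a = 2 the sum is 4 + 4 + 6 = 14; each further step adds 2 a and 2 a +
  1 with weight 1.\<close>

lemma sum_mult_bound:
  assumes "2 \<le> a"
  shows "(\<Sum>d\<in>{1..<2 * a}. d * mult_bound d) + a = 2 * a\<^sup>2 + 8"
  using assms
proof (induction a rule: nat_induct_at_least)
  case base
  have "{1..<2 * 2} = {1, 2, 3 :: nat}" by auto
  then show ?case by (simp add: mult_bound_def)
next
  case (Suc a)
  have "{1..<2 * Suc a} = insert (2 * a + 1) (insert (2 * a) {1..<2 * a})" using Suc by auto
  then show ?case using Suc by (simp add: mult_bound_def power2_eq_square)
qed

lemma failure_fraction_eq: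
  "failure_fraction l a s = real (card (failing l a s)) / (real l * (2 * real s + 1))"
proof -
  have "{n. s\<^sup>2 * l \<le> n \<and> n < (s + 1)\<^sup>2 * l} = {s\<^sup>2 * l..<(s + 1)\<^sup>2 * l}" by auto
  then have "card {n. s\<^sup>2 * l \<le> n \<and> n < (s + 1)\<^sup>2 * l} = (s + 1)\<^sup>2 * l - s\<^sup>2 * l" by simp
  also have "\<dots> = l * (2 * s + 1)" by (simp add: power2_eq_square algebra_simps)
  finally have *: "real (card {n. s\<^sup>2 * l \<le> n \<and> n < (s + 1)\<^sup>2 * l}) = real l * (2 * real s + 1)"
    by (simp add: algebra_simps)
  show ?thesis unfolding failure_fraction_def failing_def * ..
qed

lemma failure_fraction_le_of_card:
  assumes "real (card (failing l a s)) \<le> C"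
  shows "failure_fraction l a s \<le> C / (real l * (2 * real s + 1))"
  unfolding failure_fraction_eq using assms by (intro divide_right_mono) auto

text \<open>For a = 1 only d = 1 occurs, with l - 1 values of r and at most four n for each: at most
  3 + 4 (l - 1) failures.\<close>

lemma card_failing_one_le:
  assumes "0 < s" "0 < l"
  shows "real (card (failing l 1 s)) \<le> 4 * real l + 2"
proof -
  have "card (failing l 1 s) \<le> 3 + (l - 1) * 4"
    using card_failing_le[OF assms, of 1] by (simp add: mult_bound_def numeral_2_eq_2)
  then show ?thesis using assms by linarith
qed

lemma card_failing_ge_two_le:
  assumes "0 < s" "0 < l" "2 \<le> a"
  shows "real (card (failing l a s)) \<le> (2 * (real a)\<^sup>2 - real a + 8) * real l + 3"
proof -
  define T where "T = (\<Sum>d\<in>{1..<2 * a}. d * mult_bound d)"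
  have "card (failing l a s) \<le> 3 + (\<Sum>d\<in>{1..<2 * a}. (d * l - 1) * mult_bound d)"
    using assms by (intro card_failing_le) auto
  also have "(\<Sum>d\<in>{1..<2 * a}. (d * l - 1) * mult_bound d) \<le> (\<Sum>d\<in>{1..<2 * a}. l * (d * mult_bound d))"
  proof (rule sum_mono)
    fix d
    have "(d * l - 1) * mult_bound d \<le> d * l * mult_bound d" by (intro mult_le_mono1) simp
    then show "(d * l - 1) * mult_bound d \<le> l * (d * mult_bound d)" by (simp only: mult_ac)
  qed
  also have "\<dots> = l * T" by (simp add: T_def sum_distrib_left)
  finally have "card (failing l a s) \<le> 3 + l * T" by simp
  then have "real (card (failing l a s)) \<le> real (3 + l * T)" by (simp only: of_nat_le_iff)
  moreover have "real T = 2 * (real a)\<^sup>2 - real a + 8"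
    using arg_cong[OF sum_mult_bound[OF assms(3)], of real] unfolding T_def[symmetric] by simp
  ultimately show ?thesis by (simp add: mult.commute add.commute)
qed

text \<open>The number of failures is bounded independently of s, while the range has l (2 s + 1)
  elements.\<close>

lemma failure_fraction_tendsto_0:
  assumes "0 < l" "0 < a"
  shows "(\<lambda>s. failure_fraction l a s) \<longlonglongrightarrow> 0"
proof -
  define C where "C = real (3 + (\<Sum>d\<in>{1..<2 * a}. (d * l - 1) * mult_bound d))"
  show ?thesis
  proof (rule tendsto_sandwich)
    show "\<forall>\<^sub>F s in sequentially. 0 \<le> failure_fraction l a s"
      by (simp add: failure_fraction_eq)
    show "\<forall>\<^sub>F s in sequentially. failure_fraction l a s \<le> C / real s"
      using eventually_gt_at_top[of 0]
    proof eventually_elim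
      case (elim s)
      have "failure_fraction l a s \<le> C / (real l * (2 * real s + 1))"
        using card_failing_le[OF elim assms] unfolding C_def
        by (intro failure_fraction_le_of_card) (simp only: of_nat_le_iff)
      also have "\<dots> \<le> C / real s"
      proof (rule divide_left_mono)
        have "1 * real s \<le> real l * (2 * real s + 1)" using assms by (intro mult_mono) auto
        then show "real s \<le> real l * (2 * real s + 1)" by simp
        show "0 \<le> C" unfolding C_def by (rule of_nat_0_le_iff)
      qed (use elim assms in auto)
      finally show ?case .
    qed
    show "(\<lambda>s. C / real s) \<longlonglongrightarrow> 0" by (rule lim_const_over_n)
  qed simp
qed

section \<open>Fixed n and l in the upper half\<close>

definition upper_half :: "nat \<Rightarrow> nat set" where
  "upper_half n = {k. (real n - 1) / 2 \<le> real k \<and> real k \<le> real n - 1}"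

definition upper_half_good :: "nat \<Rightarrow> nat set" where
  "upper_half_good n = {k. (real n - 1) / 2 \<le> real k \<and> real k \<le> real n - 1 \<and>
     eps n k > sqrt (real k / real n) * sqrt (1 - 1 / real n)}"

lemma upper_half_eq:
  assumes "0 < n"
  shows "upper_half n = {n div 2..<n}"
proof -
  have "(real n - 1) / 2 \<le> real k \<longleftrightarrow> real n \<le> real (2 * k + 1)"
    "real k \<le> real n - 1 \<longleftrightarrow> real (k + 1) \<le> real n" for k
    by (auto simp: field_simps)
  then show ?thesis unfolding upper_half_def of_nat_le_iff by auto
qed

text \<open>The criterion with a = d = 1, kept one-sided: for n = 3, k = 1, r = 2 the difference r^2
  - n k equals k, so the symmetric criterion would fail.\<close>

lemma upper_half_goodI:
  assumes "0 < k" "n \<le> 2 * k + 1" "k < n" "0 < r" "r \<le> n"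
    and "int n * ((int r)\<^sup>2 - int n * int k) < (int r)\<^sup>2"
    and "int n * int k - (int r)\<^sup>2 < int k"
  shows "k \<in> upper_half_good n"
proof -
  have "sqrt (real k / real n) * sqrt (1 - 1 / (real 1 * real n)) < eps n k"
    using assms by (intro eps_gt_if_close[of n k 1 r 1]) auto
  then show ?thesis using assms(2,3) by (simp add: upper_half_good_def)
qed

lemma finite_upper_half_good:
  assumes "0 < n"
  shows "finite (upper_half_good n)"
  by (rule finite_subset[of _ "upper_half n"])
    (use assms upper_half_eq[of n] in \<open>auto simp: upper_half_good_def upper_half_def\<close>)

text \<open>The fraction 5/7 is chosen slightly above 1/sqrt 2, so that 2 r^2 > n^2. This places the
  rounded value in the upper half and lets the rounding error n/2 pass both tests of
  \<open>upper_half_goodI\<close>.\<close>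

lemma card_upper_half_good_ge:
  assumes "2 < n"
  shows "n - (5 * n + 6) div 7 \<le> card (upper_half_good n)"
proof -
  \<comment> \<open>The lower end is 5 n/7 rounded up, and \<open>f\<close> below rounds r^2/n to
    the nearest integer.\<close>
  define R where "R = {(5 * n + 6) div 7..<n}"
  define f where "f r = (2 * r\<^sup>2 + n) div (2 * n)" for r
  have R: "5 * n \<le> 7 * r" "r < n" if "r \<in> R" for r using that by (auto simp: R_def)
  have strict: "f r < f r'" if "r \<in> R" "r < r'" for r r'
  proof -
    \<comment> \<open>The square grows by at least 2 r + 1 >= n, so the numerator in
      \<open>f\<close> gains at least 2 n and the quotient at least 1.\<close>
    have "(r + 1)\<^sup>2 \<le> r'\<^sup>2" using that by (intro power_mono) auto
    then have "(2 * r\<^sup>2 + n) + 2 * n \<le> 2 * r'\<^sup>2 + n"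
      using R[OF that(1)] by (simp add: power2_eq_square)
    then have "((2 * r\<^sup>2 + n) + 2 * n) div (2 * n) \<le> f r'" unfolding f_def by (rule div_le_mono)
    moreover have "((2 * r\<^sup>2 + n) + 2 * n) div (2 * n) = f r + 1"
      unfolding f_def using assms by (subst div_add_self2) auto
    ultimately show ?thesis by linarith
  qed
  have "inj_on f R"
    by (rule inj_onI) (metis strict less_irrefl linorder_neqE_nat)
  moreover have "f ` R \<subseteq> upper_half_good n"
  proof clarify
    fix r assume r: "r \<in> R"
    define k where "k = f r"
    have "(2 * r\<^sup>2 + n) div (2 * n) * (2 * n) \<le> 2 * r\<^sup>2 + n" by simp
    then have lo: "2 * n * k \<le> 2 * r\<^sup>2 + n" by (simp add: k_def f_def mult.commute mult.left_commute)
    have "2 * r\<^sup>2 + n < (2 * n) + (2 * n) * ((2 * r\<^sup>2 + n) div (2 * n))"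
      using assms by (intro dividend_less_times_div) simp
    then have hi: "2 * r\<^sup>2 < 2 * n * k + n" by (simp add: k_def f_def)
    have "(5 * n)\<^sup>2 \<le> (7 * r)\<^sup>2" using R[OF r] by (intro power_mono) auto
    then have "25 * n\<^sup>2 \<le> 49 * r\<^sup>2" by (simp add: power_mult_distrib)
    moreover have "0 < n\<^sup>2" using assms by simp
    ultimately have sq: "n\<^sup>2 < 2 * r\<^sup>2" by linarith
    have "n * n < n * (2 * k + 1)" using sq hi by (simp add: power2_eq_square algebra_simps)
    then have k1: "n < 2 * k + 1" using mult_less_cancel1[of n n "2 * k + 1"] by blast
    have "r\<^sup>2 \<le> (n - 1)\<^sup>2" using R[OF r] by (intro power_mono) auto
    moreover have "(n - 1)\<^sup>2 + 2 * n = n * n + 1"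
      using assms by (cases n) (auto simp: power2_eq_square)
    ultimately have "2 * n * k < 2 * n * n" using lo assms by linarith
    then have k2: "k < n" by simp
    have "int n * (2 * ((int r)\<^sup>2 - int n * int k)) \<le> int n * int n"
    proof (rule mult_left_mono)
      have "int (2 * r\<^sup>2) < int (2 * n * k + n)" using hi by linarith
      then show "2 * ((int r)\<^sup>2 - int n * int k) \<le> int n" by simp
    qed simp
    then have "2 * (int n * ((int r)\<^sup>2 - int n * int k)) \<le> int (n\<^sup>2)"
      by (simp only: of_nat_power power2_eq_square[of "int n"] mult.left_commute)
    also have "\<dots> < int (2 * r\<^sup>2)" using sq by linarith
    finally have above: "int n * ((int r)\<^sup>2 - int n * int k) < (int r)\<^sup>2"
      by simp
    \<comment> \<open>Rounding gives n k - r^2 <= n/2, which suffices if n < 2 k. If 2 k <= n, then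
      n k <= n^2/2 < r^2 and the left side is negative.\<close>
    have below: "int n * int k - (int r)\<^sup>2 < int k"
    proof (cases "n < 2 * k")
      case True
      have "int (2 * n * k) \<le> int (2 * r\<^sup>2 + n)" using lo by linarith
      then have "2 * (int n * int k - (int r)\<^sup>2) \<le> int n" by simp
      moreover have "int n < 2 * int k" using True by simp
      moreover have "x < z" if "2 * x \<le> y" "y < 2 * z" for x y z :: int using that by linarith
      ultimately show ?thesis by blast
    next
      case False
      have "2 * (n * k) = n * (2 * k)" by simp
      also have "\<dots> \<le> n * n" using False by (intro mult_le_mono2) simp
      also have "\<dots> = n\<^sup>2" by (simp add: power2_eq_square)
      also have "\<dots> < 2 * r\<^sup>2" by (rule sq)
      finally have "n * k < r\<^sup>2" by simp
      then have "int (n * k) < int (r\<^sup>2)" by linarith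
      then show ?thesis by simp
    qed
    have "k \<in> upper_half_good n"
      using k1 k2 above below R[OF r] assms by (intro upper_half_goodI[of k n r]) auto
    then show "f r \<in> upper_half_good n" by (simp add: k_def)
  qed
  moreover have "finite (upper_half_good n)"
    using assms by (intro finite_upper_half_good) auto
  ultimately have "card R \<le> card (upper_half_good n)" by (metis card_inj_on_le)
  then show ?thesis by (simp add: R_def)
qed

lemma half_le_card_upper_half_good:
  assumes "2 < n"
  shows "real (card (upper_half n)) / 2 \<le> real (card (upper_half_good n))"
proof -
  have "n - n div 2 \<le> 2 * card (upper_half_good n)"
    \<comment> \<open>the only \<open>n > 2\<close> for which the count of \<open>r\<close> with \<open>5 n \<le> 7 r < 7 n\<close> is too small\<close>
  proof (cases "n \<in> {3, 5, 6, 9, 10, 13, 17}")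
    case False
    have "n - n div 2 \<le> 2 * (n - (5 * n + 6) div 7)"
    \<comment> \<open>The right side is at least (4 n - 12)/7 and the left at most (n + 1)/2, so
      large n are settled by linear arithmetic and the others by evaluation.\<close>
    proof (cases "n \<le> 31")
      case True
      then have "n \<in> set [3..<32]" unfolding set_upt using assms by simp
      moreover have "\<forall>m\<in>set [3..<32]. m \<notin> {3, 5, 6, 9, 10, 13, 17} \<longrightarrow> m - m div 2 \<le> 2 * (m - (5 * m + 6) div 7)"
        by code_simp
      ultimately have "n \<notin> {3, 5, 6, 9, 10, 13, 17} \<longrightarrow> n - n div 2 \<le> 2 * (n - (5 * n + 6) div 7)"
        by (rule bspec[rotated])
      then show ?thesis using False by (rule mp)
    next
      case False
      then show ?thesis by linarith
    qed
    then show ?thesis using card_upper_half_good_ge[OF assms] by linarith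
  next
    case True
    \<comment> \<open>Each exceptional n gets an explicit set of just enough good values; the values
      of r supplied are their witnesses in the same order.\<close>
    have I: "card A \<le> card (upper_half_good n)" if "A \<subseteq> upper_half_good n" for A
      using that assms by (intro card_mono finite_upper_half_good) auto
    from True consider "n = 3" | "n = 5" | "n = 6" | "n = 9" | "n = 10" | "n = 13" | "n = 17" by blast
    then show ?thesis
    proof cases
      case 1
      have "{1} \<subseteq> upper_half_good n"
        unfolding 1 by (simp add: upper_half_goodI[where r = 2])
      from I[OF this] show ?thesis unfolding 1 by simp
    next
      case 2
      have "{2, 3} \<subseteq> upper_half_good n"
        unfolding 2 by (simp add: upper_half_goodI[where r = 3] upper_half_goodI[where r = 4])
      from I[OF this] show ?thesis unfolding 2 by simp
    next
      case 3
      have "{3, 4} \<subseteq> upper_half_good n"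
        unfolding 3 by (simp add: upper_half_goodI[where r = 4] upper_half_goodI[where r = 5])
      from I[OF this] show ?thesis unfolding 3 by simp
    next
      case 4
      have "{4, 5, 7} \<subseteq> upper_half_good n"
        unfolding 4 by (simp add: upper_half_goodI[where r = 6] upper_half_goodI[where r = 7]
            upper_half_goodI[where r = 8])
      from I[OF this] show ?thesis unfolding 4 by simp
    next
      case 5
      have "{5, 6, 8} \<subseteq> upper_half_good n"
        unfolding 5 by (simp add: upper_half_goodI[where r = 7] upper_half_goodI[where r = 8]
            upper_half_goodI[where r = 9])
      from I[OF this] show ?thesis unfolding 5 by simp
    next
      case 6
      have "{6, 8, 9, 11} \<subseteq> upper_half_good n"
        unfolding 6 by (simp add: upper_half_goodI[where r = 9] upper_half_goodI[where r = 10]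
            upper_half_goodI[where r = 11] upper_half_goodI[where r = 12])
      from I[OF this] show ?thesis unfolding 6 by simp
    next
      case 7
      have "{8, 10, 11, 13, 15} \<subseteq> upper_half_good n"
        unfolding 7 by (simp add: upper_half_goodI[where r = 12] upper_half_goodI[where r = 13]
            upper_half_goodI[where r = 14] upper_half_goodI[where r = 15] upper_half_goodI[where r = 16])
      from I[OF this] show ?thesis unfolding 7 by simp
    qed
  qed
  moreover have "card (upper_half n) = n - n div 2"
    using upper_half_eq[of n] assms by simp
  ultimately show ?thesis by linarith
qed

section \<open>Assembly of parts (a), (b) and (c)\<close>

theorem mainTheorem2:
  fixes l n :: nat
  assumes "0 < l" and "0 < n"
  shows
    "(l \<ge> n \<longrightarrow> eps n l = 1)
   \<and> (l < n \<longrightarrow>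
        (is_square (n * l) \<longrightarrow> eps n l = sqrt (real l / real n))
      \<and> (\<forall>(d::nat) (r::nat) (\<delta>::int).
           0 < d \<and> 0 < r \<and> r \<le> n \<and> \<delta> = (int r)\<^sup>2 - int n * int l * (int d)\<^sup>2 \<longrightarrow>
             (\<delta> \<ge> 0 \<longrightarrow>
                eps n l \<ge> sqrt (real l / real n) * sqrt (1 - real_of_int \<delta> / (real r)\<^sup>2))
           \<and> (\<delta> \<le> 0 \<longrightarrow>
                eps n l \<ge> sqrt (real l / real n)
                  * sqrt (1 + real_of_int \<delta> / (real n * real l * (real d)\<^sup>2)))
           \<and> (\<delta> = 1 \<longrightarrow>
                eps n l = sqrt (real l / real n) * sqrt (1 - real_of_int \<delta> / (real r)\<^sup>2))
           \<and> (\<delta> = -1 \<longrightarrow>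
                eps n l = sqrt (real l / real n)
                  * sqrt (1 + real_of_int \<delta> / (real n * real l * (real d)\<^sup>2)))))
   \<and> (n > 2 \<longrightarrow>
        real (card {k::nat. (real n - 1) / 2 \<le> real k \<and> real k \<le> real n - 1 \<and>
                eps n k > sqrt (real k / real n) * sqrt (1 - 1 / real n)})
        \<ge> real (card {k::nat. (real n - 1) / 2 \<le> real k \<and> real k \<le> real n - 1}) / 2)
   \<and> (\<forall>(m::nat) (a::nat). 0 < m \<and> 0 < a \<longrightarrow>
        (\<forall>s>2.
           (a > 2 \<longrightarrow> failure_fraction m a s
              \<le> ((2 * (real a)\<^sup>2 - real a + 8) * real m + 3) / (real m * (2 * real s + 1)))
         \<and> (a = 2 \<longrightarrow> failure_fraction m a s
              \<le> (14 * real m + 3) / (real m * (2 * real s + 1)))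
         \<and> (a = 1 \<longrightarrow> failure_fraction m a s
              \<le> (4 * real m + 2) / (real m * (2 * real s + 1))))
      \<and> (\<lambda>s. failure_fraction m a s) \<longlonglongrightarrow> 0)
   \<and> (\<not> is_square (n + 1) \<and> \<not> is_square (n - 1) \<longrightarrow>
        eps n 1 > 1 / sqrt (real n + 1)
      \<and> 1 / sqrt (real n + 1) > sqrt (1 / real n) * sqrt (1 - 1 / real n))"
proof (intro conjI)
  show "l \<ge> n \<longrightarrow> eps n l = 1" using eps_eq_1 assms by blast
next
  show "l < n \<longrightarrow>
        (is_square (n * l) \<longrightarrow> eps n l = sqrt (real l / real n))
      \<and> (\<forall>(d::nat) (r::nat) (\<delta>::int).
           0 < d \<and> 0 < r \<and> r \<le> n \<and> \<delta> = (int r)\<^sup>2 - int n * int l * (int d)\<^sup>2 \<longrightarrow>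
             (\<delta> \<ge> 0 \<longrightarrow>
                eps n l \<ge> sqrt (real l / real n) * sqrt (1 - real_of_int \<delta> / (real r)\<^sup>2))
           \<and> (\<delta> \<le> 0 \<longrightarrow>
                eps n l \<ge> sqrt (real l / real n)
                  * sqrt (1 + real_of_int \<delta> / (real n * real l * (real d)\<^sup>2)))
           \<and> (\<delta> = 1 \<longrightarrow>
                eps n l = sqrt (real l / real n) * sqrt (1 - real_of_int \<delta> / (real r)\<^sup>2))
           \<and> (\<delta> = -1 \<longrightarrow>
                eps n l = sqrt (real l / real n)
                  * sqrt (1 + real_of_int \<delta> / (real n * real l * (real d)\<^sup>2))))"
  proof (rule impI, rule conjI, goal_cases)
    case 1
    then show ?case using eps_square assms by blast
  next
    case 2
    show ?case
    proof (intro allI impI, elim conjE, goal_cases)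
      case (1 d r \<delta>)
      \<comment> \<open>In this form the sign and value conditions on \<open>\<delta>\<close>
        translate linearly into relations between the naturals r^2 and n l d^2.\<close>
      have \<delta>: "\<delta> = int (r\<^sup>2) - int (n * l * d\<^sup>2)" using 1 by simp
      note above = scaled_ratio_above[OF assms(2) 1(2,4)]
      note below = scaled_ratio_below[OF assms(2,1) 1(1,4)]
      show ?case unfolding above below
      proof (intro conjI impI)
        assume "0 \<le> \<delta>"
        then have "n * l * d\<^sup>2 \<le> r\<^sup>2" unfolding \<delta> by linarith
        then show "real d * real l / real r \<le> eps n l"
          using eps_ge_above assms 1 by blast
      next
        assume "\<delta> \<le> 0"
        then have "r\<^sup>2 \<le> n * l * d\<^sup>2" unfolding \<delta> by linarith
        then show "real r / (real n * real d) \<le> eps n l"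
          using eps_ge_below assms 1 by blast
      next
        assume "\<delta> = 1"
        then have "r\<^sup>2 = n * l * d\<^sup>2 + 1" unfolding \<delta> by linarith
        then show "eps n l = real d * real l / real r"
          using eps_pell_pos assms 1 by blast
      next
        assume "\<delta> = -1"
        then have "r\<^sup>2 + 1 = n * l * d\<^sup>2" unfolding \<delta> by linarith
        then show "eps n l = real r / (real n * real d)"
          using eps_pell_neg assms 1 by blast
      qed
    qed
  qed
next
  show "n > 2 \<longrightarrow>
        real (card {k::nat. (real n - 1) / 2 \<le> real k \<and> real k \<le> real n - 1 \<and>
                eps n k > sqrt (real k / real n) * sqrt (1 - 1 / real n)})
        \<ge> real (card {k::nat. (real n - 1) / 2 \<le> real k \<and> real k \<le> real n - 1}) / 2"
    using half_le_card_upper_half_good[of n] unfolding upper_half_def upper_half_good_def by blast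
next
  show "\<forall>(m::nat) (a::nat). 0 < m \<and> 0 < a \<longrightarrow>
        (\<forall>s>2.
           (a > 2 \<longrightarrow> failure_fraction m a s
              \<le> ((2 * (real a)\<^sup>2 - real a + 8) * real m + 3) / (real m * (2 * real s + 1)))
         \<and> (a = 2 \<longrightarrow> failure_fraction m a s
              \<le> (14 * real m + 3) / (real m * (2 * real s + 1)))
         \<and> (a = 1 \<longrightarrow> failure_fraction m a s
              \<le> (4 * real m + 2) / (real m * (2 * real s + 1))))
      \<and> (\<lambda>s. failure_fraction m a s) \<longlonglongrightarrow> 0"
  proof (intro allI impI conjI, goal_cases)
    case (1 m a s)
    then show ?case by (intro failure_fraction_le_of_card card_failing_ge_two_le) auto
  next
    case (2 m a s)
    \<comment> \<open>At a = 2 the coefficient 2 a^2 - a + 8 equals 14.\<close>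
    then have "real (card (failing m 2 s)) \<le> 14 * real m + 3"
      using card_failing_ge_two_le[of s m 2] by simp
    with 2 show ?case by (simp only: failure_fraction_le_of_card)
  next
    case (3 m a s)
    then have "real (card (failing m 1 s)) \<le> 4 * real m + 2"
      by (intro card_failing_one_le) auto
    with 3 show ?case by (simp only: failure_fraction_le_of_card)
  next
    case (4 m a)
    then show ?case by (intro failure_fraction_tendsto_0) auto
  qed
next
  show "\<not> is_square (n + 1) \<and> \<not> is_square (n - 1) \<longrightarrow>
        eps n 1 > 1 / sqrt (real n + 1)
      \<and> 1 / sqrt (real n + 1) > sqrt (1 / real n) * sqrt (1 - 1 / real n)"
    using eps_one_gt threshold_one assms by blast
qed

end
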